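(* Let $a\ge 3$ and $t\ge 2$ be fixed integers. Then there exist constants $c_1=c_1(a,t)>0$, $\lambda_1=\lambda_1(a,t)>1$, $c_2=c_2(a)>0$ and $\lambda_2=\lambda_2(a)<2$ (where $c_2$ and $\lambda_2$ depend only on $a$), and an integer $n_0(a,t)\ge a^t$, such that for all $n\ge n_0(a,t)$, $$p(a,t,n)\ge c_1\lambda_1^n \quad\text{and}\quad p(a,2,n)\le c_2\lambda_2^n.$$ In particular, $$p(a,t,n)\le p(a,2,n)\le\binom{n-1}{\lfloor n/a\rfloor-1}$$ for all $n\ge n_0(a,t)$.
   Context: Let $\Sigma_a=\{0,1,\ldots,a-1\}$ with $a\ge 2$, and let $t\ge 2$. For $\mathbf{v}\in\Sigma_a^n$ and $r\in[n]=\{1,\ldots,n\}$, $\mathbf{v}[r]$ denotes the $r$-th coordinate of $\mathbf{v}$. A set of vectors $\mathcal{V}=\{\mathbf{v}_1,\ldots,\mathbf{v}_k\}\subseteq \Sigma_a^n$ is called $t$-wise perfect with respect to $\Sigma_a$ if (i) $|\mathcal{V}|\ge t$, and (ii) for every $t$-tuple $(\mathbf{v}_{i_1},\ldots,\mathbf{v}_{i_t})$ with $1\le i_1<i_2<\cdots<i_t\le k$ and every string $\alpha\in\Sigma_a^t$, there is some $r\in[n]$ with $\mathbf{v}_{i_1}[r]\cdots\mathbf{v}_{i_t}[r]=\alpha$. For $n\ge a^t$ (for which such sets exist), $p(a,t,n)$ denotes the maximum size of a $t$-wise perfect set of vectors of length $n$ over $\Sigma_a$. *)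

theory Defs
  imports Complex_Main "HOL-Library.FuncSet"
begin

definition vecs :: "nat \<Rightarrow> nat \<Rightarrow> (nat \<Rightarrow> nat) set" where
  "vecs a n = {1..n} \<rightarrow>\<^sub>E {0..<a}"

text \<open>The set is enumerated as v 1, ..., v k with k = card V; by lemma \<open>perfect_on_iff\<close> below,
  the choice of enumeration does not matter. The number t of positions is the length of the
  strings, and i 1 < ... < i t selects the tuple.\<close>

definition perfect_on :: "nat \<Rightarrow> nat \<Rightarrow> nat \<Rightarrow> nat \<Rightarrow> (nat \<Rightarrow> nat \<Rightarrow> nat) \<Rightarrow> bool" where
  "perfect_on a t n k v \<longleftrightarrow>
     (\<forall>i::nat \<Rightarrow> nat. strict_mono_on {1..t} i \<and> i ` {1..t} \<subseteq> {1..k} \<longrightarrow>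
        (\<forall>\<alpha>\<in>vecs a t. \<exists>r\<in>{1..n}. \<forall>j\<in>{1..t}. v (i j) r = \<alpha> j))"

definition wise_perfect :: "nat \<Rightarrow> nat \<Rightarrow> nat \<Rightarrow> (nat \<Rightarrow> nat) set \<Rightarrow> bool" where
  "wise_perfect a t n V \<longleftrightarrow>
     V \<subseteq> vecs a n \<and> t \<le> card V \<and>
     (\<exists>v. bij_betw v {1..card V} V \<and> perfect_on a t n (card V) v)"

text \<open>The maximum is over a nonempty set (and hence meaningful) at least when \<open>2 \<le> a\<close> and \<open>a ^ t \<le> n\<close>;
  it is unspecified if no such set of vectors exists.\<close>

definition perfect_num :: "nat \<Rightarrow> nat \<Rightarrow> nat \<Rightarrow> nat" where
  "perfect_num a t n = Max {card V |V. wise_perfect a t n V}"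

lemma perfect_on_iff:
  assumes v: "bij_betw v {1..k} V"
  shows "perfect_on a t n k v \<longleftrightarrow>
    (\<forall>u. inj_on u {1..t} \<and> u ` {1..t} \<subseteq> V \<longrightarrow>
        (\<forall>\<alpha>\<in>vecs a t. \<exists>r\<in>{1..n}. \<forall>j\<in>{1..t}. u j r = \<alpha> j))" (is "_ \<longleftrightarrow> ?R")
proof
  assume R: ?R
  show "perfect_on a t n k v"
    unfolding perfect_on_def
  proof (intro allI impI ballI, elim conjE)
    fix i :: "nat \<Rightarrow> nat" and \<alpha>
    assume i: "strict_mono_on {1..t} i" "i ` {1..t} \<subseteq> {1..k}" and \<alpha>: "\<alpha> \<in> vecs a t"
    have "inj_on (v \<circ> i) {1..t}"
      by (meson bij_betw_imp_inj_on comp_inj_on i inj_on_subset strict_mono_on_imp_inj_on v)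
    moreover have "(v \<circ> i) ` {1..t} \<subseteq> V"
      using v i(2) by (auto simp: bij_betw_def)
    ultimately show "\<exists>r\<in>{1..n}. \<forall>j\<in>{1..t}. v (i j) r = \<alpha> j"
      using R[rule_format, of "v \<circ> i" \<alpha>] \<alpha> by simp
  qed
next
  assume L: "perfect_on a t n k v"
  show ?R
  proof (intro allI impI ballI, elim conjE)
    fix u and \<alpha>
    assume u: "inj_on u {1..t}" "u ` {1..t} \<subseteq> V" and \<alpha>: "\<alpha> \<in> vecs a t"
    define w where "w = inv_into {1..k} v"
    have w: "bij_betw w V {1..k}" "\<And>x. x \<in> V \<Longrightarrow> v (w x) = x"
      using v unfolding w_def by (auto intro: bij_betw_inv_into simp: bij_betw_inv_into_right)
    define S where "S = (w \<circ> u) ` {1..t}"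
    have inj: "inj_on (w \<circ> u) {1..t}"
      by (meson bij_betw_imp_inj_on comp_inj_on u inj_on_subset w(1))
    have S: "finite S" "card S = t" "S \<subseteq> {1..k}"
    proof -
      show "finite S" by (simp add: S_def)
      show "card S = t" unfolding S_def by (simp only: card_image[OF inj]) simp
      show "S \<subseteq> {1..k}" unfolding S_def using u(2) bij_betwE[OF w(1)] by fastforce
    qed
    define xs where "xs = sorted_list_of_set S"
    have xs: "length xs = t" "set xs = S" "sorted_wrt (<) xs"
      using S by (auto simp: xs_def)
    define i where "i j = xs ! (j - 1)" for j
    have i_mono: "strict_mono_on {1..t} i"
    proof (rule strict_mono_onI)
      fix l m assume "l \<in> {1..t}" "m \<in> {1..t}" "l < m"
      hence "l - 1 < m - 1" "m - 1 < length xs" unfolding xs(1) by auto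
      thus "i l < i m" unfolding i_def by (rule sorted_wrt_nth_less[OF xs(3)])
    qed
    have i_img: "i ` {1..t} \<subseteq> S"
    proof
      fix x assume "x \<in> i ` {1..t}"
      then obtain j where "j \<in> {1..t}" "x = xs ! (j - 1)" unfolding i_def by blast
      moreover from this have "j - 1 < length xs" unfolding xs(1) by auto
      ultimately show "x \<in> S" using nth_mem xs(2) by blast
    qed
    have "i ` {1..t} = S"
    proof (rule card_subset_eq[OF S(1) i_img])
      show "card (i ` {1..t}) = card S"
        unfolding S(2) by (simp only: card_image[OF strict_mono_on_imp_inj_on[OF i_mono]]) simp
    qed
    hence bi: "bij_betw i {1..t} S"
      using strict_mono_on_imp_inj_on[OF i_mono] by (simp add: bij_betw_def)
    have bw: "bij_betw (w \<circ> u) {1..t} S"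
      using inj by (simp add: bij_betw_def S_def)
    define q where "q = inv_into {1..t} (w \<circ> u) \<circ> i"
    have q: "bij_betw q {1..t} {1..t}"
      unfolding q_def by (rule bij_betw_trans[OF bi bij_betw_inv_into[OF bw]])
    have wq: "w (u (q j)) = i j" if "j \<in> {1..t}" for j
    proof -
      have "i j \<in> S" using bij_betwE[OF bi] that by blast
      from bij_betw_inv_into_right[OF bw this] show ?thesis unfolding q_def o_apply .
    qed
    have vi: "v (i j) = u (q j)" if "j \<in> {1..t}" for j
    proof -
      have "u (q j) \<in> V" using u(2) bij_betwE[OF q] that by blast
      from w(2)[OF this] show ?thesis unfolding wq[OF that] .
    qed
    define \<beta> where "\<beta> = restrict (\<alpha> \<circ> q) {1..t}"
    have \<beta>: "\<beta> \<in> vecs a t"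
      unfolding vecs_def \<beta>_def
    proof (rule restrict_PiE_iff[THEN iffD2], intro ballI)
      fix j assume "j \<in> {1..t}"
      hence "q j \<in> {1..t}" using bij_betwE[OF q] by blast
      thus "(\<alpha> \<circ> q) j \<in> {0..<a}" using PiE_mem[OF \<alpha>[unfolded vecs_def]] by (simp only: o_apply)
    qed
    have i_sub: "i ` {1..t} \<subseteq> {1..k}" using i_img S(3) by (rule subset_trans)
    have "\<exists>r\<in>{1..n}. \<forall>j\<in>{1..t}. v (i j) r = \<beta> j"
      by (rule L[unfolded perfect_on_def, THEN spec, THEN mp, OF conjI[OF i_mono i_sub], THEN bspec, OF \<beta>])
    then obtain r where r: "r \<in> {1..n}" "\<forall>j\<in>{1..t}. v (i j) r = \<beta> j"
      by (rule bexE)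
    have "u m r = \<alpha> m" if "m \<in> {1..t}" for m
    proof -
      have "m \<in> q ` {1..t}" using that by (simp only: bij_betw_imp_surj_on[OF q])
      then obtain j where j: "m = q j" "j \<in> {1..t}" by (rule imageE)
      have "u m r = v (i j) r" by (simp only: vi[OF j(2)] j(1))
      also have "\<dots> = \<beta> j" using r(2) j(2) by (rule bspec)
      also have "\<dots> = \<alpha> m" using j by (simp add: \<beta>_def)
      finally show ?thesis .
    qed
    thus "\<exists>r\<in>{1..n}. \<forall>j\<in>{1..t}. u j r = \<alpha> j" using r(1) by blast
  qed
qed

end

theory Submission
  imports Defs "HOL-Combinatorics.Permutations"
begin

text \<open>Upper bound: each vector \<open>v\<close> of a 2-wise perfect set has a level set of size at most
  \<open>k = n div a\<close>; since \<open>a \<ge> 3\<close>, it extends to a \<open>k\<close>-set \<open>B v\<close> disjoint from another level set.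
  Perfectness makes the \<open>B v\<close> pairwise intersecting (level set meets level set) and distinct
  (the level set inside \<open>B u\<close> meets the one outside \<open>B v\<close>), so the Erdos-Ko-Rado theorem applies;
  the latter is proved by Katona's cyclic arcs. Lower bound: a union bound over random families.
  Monotonicity in \<open>t\<close>: any two vectors extend to a \<open>t\<close>-tuple.\<close>

subsection \<open>The Erdos--Ko--Rado theorem\<close>

text \<open>Katona's arcs: \<open>k\<close> consecutive points, the first being \<open>i\<close>, on
  a circle whose points are the residues modulo \<open>n\<close>.\<close>

definition arc :: "nat \<Rightarrow> nat \<Rightarrow> nat \<Rightarrow> nat set" where
  "arc n k i = (\<lambda>j. (i + j) mod n) ` {..<k}"

lemma arc_subset: "0 < n \<Longrightarrow> arc n k i \<subseteq> {..<n}"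
  by (auto simp: arc_def)

lemma card_arc:
  assumes "k \<le> n"
  shows "card (arc n k i) = k"
proof -
  have eq: "x = y" if "x \<le> y" "y < k" "(i + x) mod n = (i + y) mod n" for x y
  proof -
    have "n dvd (i + y) - (i + x)" using that mod_eq_dvd_iff_nat[of "i + x" "i + y" n] by simp
    thus ?thesis using that assms nat_dvd_not_less[of "y - x" n] by (cases "x = y") auto
  qed
  have "inj_on (\<lambda>j. (i + j) mod n) {..<k}"
  proof (rule inj_onI)
    fix x y assume "x \<in> {..<k}" "y \<in> {..<k}" "(i + x) mod n = (i + y) mod n"
    thus "x = y" using eq[of x y] eq[of y x] by (cases "x \<le> y") auto
  qed
  thus ?thesis by (simp add: arc_def card_image)
qed

text \<open>At a common point \<open>i + x\<close> and \<open>j + y\<close> agree modulo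
  \<open>n\<close>, and both are below \<open>2 * n\<close>, so each wraps at most once. Equal
  wrapping gives the first alternative, wrapping of the later arc alone gives the second, and the
  earlier arc cannot wrap alone because \<open>x < k \<le> n\<close>.\<close>

lemma arcs_meet:
  assumes "i \<le> j" "j < n" "k \<le> n" "arc n k i \<inter> arc n k j \<noteq> {}"
  shows "j - i < k \<or> n - k < j - i"
proof -
  obtain x y where "x < k" "y < k" and xy: "(i + x) mod n = (j + y) mod n"
    using assms(4) by (fastforce simp: arc_def)
  have "(i + x) mod n = i + x \<or> (i + x) mod n + n = i + x"
    using assms(1-3) \<open>x < k\<close> by (auto simp: mod_if)
  moreover have "(j + y) mod n = j + y \<or> (j + y) mod n + n = j + y"
    using assms(1-3) \<open>y < k\<close> by (auto simp: mod_if)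
  ultimately consider "i + x = j + y" | "i + x + n = j + y" | "i + x = j + y + n"
    using xy by linarith
  thus ?thesis
  proof cases
    case 1
    hence "j - i < k" using assms(1) \<open>x < k\<close> by linarith
    thus ?thesis ..
  next
    case 2
    hence "n - k < j - i" using assms(1,3) \<open>y < k\<close> by linarith
    thus ?thesis ..
  next
    case 3
    thus ?thesis using assms(1,3) \<open>x < k\<close> by linarith
  qed
qed

text \<open>Distances from the least start \<open>m\<close> are below \<open>k\<close> or above
  \<open>n - k\<close>. Folding the latter back by \<open>n - k\<close> lands in
  \<open>{..<k}\<close>, and two different starts that fold together would be exactly
  \<open>n - k\<close> apart, where arcs are disjoint.\<close>

lemma card_intersecting_arcs_le:
  assumes kn: "2 * k \<le> n" and J: "J \<subseteq> {..<n}"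
    and meet: "\<And>i j. i \<in> J \<Longrightarrow> j \<in> J \<Longrightarrow> arc n k i \<inter> arc n k j \<noteq> {}"
  shows "card J \<le> k"
proof (cases "J = {}")
  case False
  have fin: "finite J" using J finite_subset by blast
  define m where "m = Min J"
  have m: "m \<in> J" "\<And>j. j \<in> J \<Longrightarrow> m \<le> j" using fin False by (auto simp: m_def)
  define f where "f j = (if j - m < k then j - m else j - m - (n - k))" for j
  have dist: "j - i < k \<or> n - k < j - i" if "i \<in> J" "j \<in> J" "i \<le> j" for i j
    using arcs_meet[of i j n k] meet that kn J by auto
  \<comment> \<open>At distance \<open>n - k\<close> both alternatives of \<open>dist\<close> fail,
    by \<open>2 * k \<le> n\<close>.\<close>
  have no: "j \<noteq> i + (n - k)" if "i \<in> J" "j \<in> J" for i j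
  proof
    assume "j = i + (n - k)"
    hence "i \<le> j" "j - i = n - k" by simp_all
    thus False using dist[OF that] kn by linarith
  qed
  have "inj_on f J"
  proof (rule inj_onI)
    fix i j assume ij: "i \<in> J" "j \<in> J" "f i = f j"
    have mi: "m \<le> i" "m \<le> j" using m(2) ij by auto
    have no': "j \<noteq> i + (n - k)" "i \<noteq> j + (n - k)" using no ij by auto
    consider "i - m < k" "j - m < k" | "i - m < k" "\<not> j - m < k" "n - k < j - m"
      | "\<not> i - m < k" "n - k < i - m" "j - m < k"
      | "\<not> i - m < k" "n - k < i - m" "\<not> j - m < k" "n - k < j - m"
      using dist[OF m(1) ij(1) mi(1)] dist[OF m(1) ij(2) mi(2)] by blast
    thus "i = j"
    proof cases
      case 1
      thus ?thesis using ij(3) mi by (simp add: f_def)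
    next
      case 2
      hence "i - m = j - m - (n - k)" using ij(3) by (simp add: f_def)
      thus ?thesis using 2 mi no' by linarith
    next
      case 3
      hence "i - m - (n - k) = j - m" using ij(3) by (simp add: f_def)
      thus ?thesis using 3 mi no' by linarith
    next
      case 4
      hence "i - m - (n - k) = j - m - (n - k)" using ij(3) by (simp add: f_def)
      thus ?thesis using 4 mi by linarith
    qed
  qed
  moreover have "f ` J \<subseteq> {..<k}"
  proof (clarify, simp)
    fix j assume "j \<in> J"
    moreover have "j < n" using \<open>j \<in> J\<close> J by auto
    ultimately show "f j < k" using m(2)[of j] dist[OF m(1), of j] by (auto simp: f_def)
  qed
  ultimately show ?thesis using card_inj_on_le[of f J "{..<k}"] by simp
qed simp

section \<open>Counting permutations by the image of a fixed set\<close>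

lemma permutes_exists_image:
  assumes "finite S" "A \<subseteq> S" "A' \<subseteq> S" "card A = card A'"
  obtains p where "p permutes S" "p ` A = A'"
proof -
  have fin: "finite A" "finite A'" using assms finite_subset by auto
  obtain f where f: "bij_betw f A A'"
    using finite_same_card_bij[OF fin assms(4)] by blast
  obtain g where g: "bij_betw g (S - A) (S - A')"
    using finite_same_card_bij[of "S - A" "S - A'"] assms fin by (auto simp: card_Diff_subset)
  \<comment> \<open>Bijections between the two sets and between their complements are glued; the
    identity outside \<open>S\<close> is what \<open>permutes\<close> demands.\<close>
  define h where "h x = (if x \<in> A then f x else if x \<in> S then g x else x)" for x
  have hA: "bij_betw h A A'"
    using f by (subst bij_betw_cong[of A h f]) (auto simp: h_def)
  have hSA: "bij_betw h (S - A) (S - A')"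
    using g by (subst bij_betw_cong[of "S - A" h g]) (auto simp: h_def)
  have "bij_betw h (A \<union> (S - A)) (A' \<union> (S - A'))"
    by (rule bij_betw_combine[OF hA hSA]) auto
  moreover have "A \<union> (S - A) = S" "A' \<union> (S - A') = S" using assms by auto
  ultimately have "h permutes S"
    using assms by (intro bij_imp_permutes) (auto simp: h_def)
  thus ?thesis using that hA by (auto simp: bij_betw_def)
qed

text \<open>By symmetry, the number of permutations mapping \<open>B\<close> onto \<open>A\<close> depends only on the size of \<open>A\<close>.\<close>

lemma card_permutations_image:
  assumes "finite S" "B \<subseteq> S" "A \<subseteq> S" "card A = card B"
  shows "card {p. p permutes S \<and> p ` B = A} * (card S choose card B) = fact (card S)"
proof -
  define P where "P = {p. p permutes S}"
  define K where "K = {A. A \<subseteq> S \<and> card A = card B}"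
  define N where "N A = card {p \<in> P. p ` B = A}" for A
  have finP: "finite P" using assms(1) by (simp add: P_def finite_permutations)
  have finK: "finite K" using assms(1) by (simp add: K_def)
  \<comment> \<open>Left composition with a permutation carrying \<open>A\<close> to
    \<open>A'\<close> injects one fibre into the other; exchanging the roles later gives
    equality.\<close>
  have le: "N A \<le> N A'" if "A \<in> K" "A' \<in> K" for A A'
  proof -
    have "A \<subseteq> S" "A' \<subseteq> S" "card A = card A'" using that by (auto simp: K_def)
    then obtain s where s: "s permutes S" "s ` A = A'"
      by (rule permutes_exists_image[OF assms(1)])
    have "inj_on ((\<circ>) s) {p \<in> P. p ` B = A}"
      using permutes_inj[OF s(1)] by (intro inj_onI) (simp add: fun_eq_iff inj_eq)
    moreover have "(\<circ>) s ` {p \<in> P. p ` B = A} \<subseteq> {p \<in> P. p ` B = A'}"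
      using s by (auto simp: P_def permutes_compose image_comp[symmetric])
    ultimately show ?thesis using finP unfolding N_def by (intro card_inj_on_le) auto
  qed
  have AK: "A \<in> K" using assms by (simp add: K_def)
  have "fact (card S) = card P" using assms(1) by (simp add: P_def card_permutations)
  also have "P = (\<Union>A\<in>K. {p \<in> P. p ` B = A})"
  proof -
    have "p ` B \<in> K" if "p \<in> P" for p
      using that image_mono[OF assms(2), of p] permutes_image[of p S]
      by (simp add: K_def P_def card_image permutes_inj_on)
    thus ?thesis by blast
  qed
  also have "card \<dots> = (\<Sum>A\<in>K. N A)"
    unfolding N_def using finK finP by (intro card_UN_disjoint) auto
  also have "\<dots> = (\<Sum>A'\<in>K. N A)" using le AK by (intro sum.cong) (auto intro: antisym)
  also have "\<dots> = card K * N A" by simp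
  also have "card K = card S choose card B" using n_subsets[OF assms(1)] by (simp add: K_def)
  finally show ?thesis by (simp add: N_def P_def mult.commute)
qed

text \<open>Katona's double count of the pairs of a permutation \<open>p\<close> of \<open>S\<close>
  and a position \<open>i\<close> such that \<open>p\<close> maps the arc \<open>B i\<close> onto a
  member of \<open>F\<close>.\<close>

theorem erdos_ko_rado:
  assumes fin: "finite S" and k: "0 < k" "2 * k \<le> card S"
    and F: "\<And>A. A \<in> F \<Longrightarrow> A \<subseteq> S \<and> card A = k"
    and meet: "\<And>A B. A \<in> F \<Longrightarrow> B \<in> F \<Longrightarrow> A \<inter> B \<noteq> {}"
  shows "card F \<le> (card S - 1) choose (k - 1)"
proof -
  define n where "n = card S"
  have n: "0 < n" "k \<le> n" "2 * k \<le> n" using k by (auto simp: n_def)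
  obtain h where h: "bij_betw h {0..<n} S"
    using ex_bij_betw_nat_finite[OF fin] by (auto simp: n_def)
  have h_inj: "inj_on h {..<n}" and h_img: "h ` {..<n} = S"
    using h by (auto simp: bij_betw_def lessThan_atLeast0)
  define B where "B i = h ` arc n k i" for i
  have B: "B i \<subseteq> S" "card (B i) = k" for i
    using arc_subset[OF n(1), of k i] h_img h_inj card_arc[OF n(2), of i]
    by (auto simp: B_def card_image inj_on_subset)
  define P where "P = {p. p permutes S}"
  have finP: "finite P" using fin by (simp add: P_def finite_permutations)
  have "F \<subseteq> Pow S" using F by blast
  hence finF: "finite F" using fin finite_subset by blast
  \<comment> \<open>Both \<open>p\<close> and \<open>h\<close> are injective, so image arcs that
    meet come from arcs that meet, and the arc bound applies.\<close>
  have row: "card {i \<in> {..<n}. p ` B i \<in> F} \<le> k" if p: "p \<in> P" for p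
  proof (rule card_intersecting_arcs_le[OF n(3)])
    fix i j assume "i \<in> {i \<in> {..<n}. p ` B i \<in> F}" "j \<in> {i \<in> {..<n}. p ` B i \<in> F}"
    hence "p ` B i \<inter> p ` B j \<noteq> {}" using meet by blast
    moreover have "inj p" using p by (simp add: P_def permutes_inj)
    ultimately have "B i \<inter> B j \<noteq> {}" by (simp flip: image_Int)
    thus "arc n k i \<inter> arc n k j \<noteq> {}"
      unfolding B_def
      by (simp flip: inj_on_image_Int[OF h_inj arc_subset[OF n(1)] arc_subset[OF n(1)]])
  qed auto
  \<comment> \<open>Sorting the permutations by the image of \<open>B i\<close> gives fibres of
    equal size; the factor \<open>n choose k\<close> avoids a division.\<close>
  have col: "card {p \<in> P. p ` B i \<in> F} * (n choose k) = card F * fact n" for i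
  proof -
    have "{p \<in> P. p ` B i \<in> F} = (\<Union>A\<in>F. {p. p permutes S \<and> p ` B i = A})"
      by (auto simp: P_def)
    also have "card \<dots> = (\<Sum>A\<in>F. card {p. p permutes S \<and> p ` B i = A})"
      using finF finP by (intro card_UN_disjoint) (auto simp: P_def)
    finally have "card {p \<in> P. p ` B i \<in> F} * (n choose k) =
        (\<Sum>A\<in>F. card {p. p permutes S \<and> p ` B i = A} * (n choose k))"
      by (simp add: sum_distrib_right)
    also have "\<dots> = (\<Sum>A\<in>F. fact n)"
    proof (rule sum.cong)
      fix A assume "A \<in> F"
      thus "card {p. p permutes S \<and> p ` B i = A} * (n choose k) = fact n"
        using card_permutations_image[OF fin B(1)[of i], of A] F[of A] B(2)[of i] by (simp add: n_def)
    qed simp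
    finally show ?thesis by simp
  qed
  have "n * (card F * fact n) = (\<Sum>i<n. card {p \<in> P. p ` B i \<in> F}) * (n choose k)"
    by (simp add: sum_distrib_right col)
  also have "(\<Sum>i<n. card {p \<in> P. p ` B i \<in> F}) = (\<Sum>p\<in>P. card {i \<in> {..<n}. p ` B i \<in> F})"
    using finP by (intro sum_multicount_gen) auto
  also have "\<dots> \<le> (\<Sum>p\<in>P. k)" by (intro sum_mono row)
  also have "\<dots> = fact n * k" using fin by (simp add: P_def card_permutations n_def)
  finally have "n * (card F * fact n) \<le> fact n * k * (n choose k)" by simp
  hence "fact n * (n * card F) \<le> fact n * (k * (n choose k))" by (simp add: ac_simps)
  hence "n * card F \<le> k * (n choose k)" by simp
  also have "\<dots> = n * ((n - 1) choose (k - 1))" using k by (simp add: times_binomial_minus1_eq)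
  finally show ?thesis using n by (simp add: n_def)
qed


subsection \<open>Perfect sets of vectors\<close>

lemma finite_vecs: "finite (vecs a n)"
  by (simp add: vecs_def finite_PiE)

lemma card_vecs: "card (vecs a n) = a ^ n"
  by (simp add: vecs_def card_PiE)

text \<open>Removes the enumeration and the increasing index tuples: \<open>V\<close> is finite, so
  an enumeration exists, and by \<open>perfect_on_iff\<close> all enumerations agree.\<close>

lemma wise_perfect_iff:
  "wise_perfect a t n V \<longleftrightarrow> V \<subseteq> vecs a n \<and> t \<le> card V \<and>
     (\<forall>u. inj_on u {1..t} \<and> u ` {1..t} \<subseteq> V \<longrightarrow>
        (\<forall>\<alpha>\<in>vecs a t. \<exists>r\<in>{1..n}. \<forall>j\<in>{1..t}. u j r = \<alpha> j))" (is "_ \<longleftrightarrow> _ \<and> _ \<and> ?R")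
proof (cases "V \<subseteq> vecs a n")
  case True
  hence "finite V" using finite_vecs finite_subset by blast
  then obtain v where v: "bij_betw v {1..card V} V" using ex_bij_betw_nat_finite_1 by blast
  have iff: "perfect_on a t n (card V) w \<longleftrightarrow> ?R" if "bij_betw w {1..card V} V" for w
    by (rule perfect_on_iff[OF that])
  have "(\<exists>w. bij_betw w {1..card V} V \<and> perfect_on a t n (card V) w) \<longleftrightarrow> ?R"
  proof
    assume "\<exists>w. bij_betw w {1..card V} V \<and> perfect_on a t n (card V) w"
    then obtain w where w: "bij_betw w {1..card V} V" "perfect_on a t n (card V) w" by blast
    from w(2) show ?R unfolding iff[OF w(1)] .
  next
    assume ?R
    hence "perfect_on a t n (card V) v" unfolding iff[OF v] .
    thus "\<exists>w. bij_betw w {1..card V} V \<and> perfect_on a t n (card V) w" using v by blast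
  qed
  thus ?thesis by (simp only: wise_perfect_def)
qed (simp add: wise_perfect_def)

text \<open>The tuple is padded with \<open>t - s\<close> elements of \<open>V\<close> outside its
  image, which exist because \<open>t \<le> card V\<close>.\<close>

lemma inj_extend:
  assumes "finite V" "inj_on u {1..s}" "u ` {1..s} \<subseteq> V" "s \<le> t" "t \<le> card V"
  obtains w where "inj_on w {1..t}" "w ` {1..t} \<subseteq> V" "\<And>j. j \<in> {1..s} \<Longrightarrow> w j = u j"
proof -
  have "card (V - u ` {1..s}) = card V - s"
    using assms by (simp add: card_Diff_subset card_image)
  then obtain W where W: "W \<subseteq> V - u ` {1..s}" "card W = t - s" "finite W"
    using assms by (metis diff_le_mono obtain_subset_with_card_n)
  obtain g where g: "bij_betw g {s+1..t} W"
    using finite_same_card_bij[of "{s+1..t}" W] W by auto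
  define w where "w j = (if j \<le> s then u j else g j)" for j
  have w1: "bij_betw w {1..s} (u ` {1..s})"
    using inj_on_imp_bij_betw[OF assms(2)] by (subst bij_betw_cong[of _ w u]) (auto simp: w_def)
  have w2: "bij_betw w {s+1..t} W"
    using g by (subst bij_betw_cong[of _ w g]) (auto simp: w_def)
  have "bij_betw w ({1..s} \<union> {s+1..t}) (u ` {1..s} \<union> W)"
    using W by (intro bij_betw_combine w1 w2) auto
  moreover have "{1..s} \<union> {s+1..t} = {1..t}" using assms(4) by auto
  ultimately have "inj_on w {1..t}" "w ` {1..t} = u ` {1..s} \<union> W"
    by (simp_all add: bij_betw_def)
  moreover have "u ` {1..s} \<union> W \<subseteq> V" using W(1) assms(3) by blast
  ultimately show ?thesis using that[of w] by (simp add: w_def)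
qed

lemma wise_perfect_antimono:
  assumes V: "wise_perfect a t n V" and "s \<le> t" "0 < a"
  shows "wise_perfect a s n V"
  unfolding wise_perfect_iff
proof (intro conjI allI impI ballI; (elim conjE)?)
  show sub: "V \<subseteq> vecs a n" and "s \<le> card V" using assms by (auto simp: wise_perfect_iff)
  fix u \<alpha> assume u: "inj_on u {1..s}" "u ` {1..s} \<subseteq> V" and \<alpha>: "\<alpha> \<in> vecs a s"
  have "finite V" using sub finite_vecs finite_subset by blast
  moreover have "t \<le> card V" using V by (simp add: wise_perfect_iff)
  ultimately obtain w where w: "inj_on w {1..t}" "w ` {1..t} \<subseteq> V" "\<And>j. j \<in> {1..s} \<Longrightarrow> w j = u j"
    using inj_extend[OF _ u \<open>s \<le> t\<close>] by metis
  \<comment> \<open>The padded positions ask for the letter 0, a legal letter by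
    \<open>0 < a\<close>.\<close>
  define \<beta> where "\<beta> = (\<lambda>j\<in>{1..t}. if j \<le> s then \<alpha> j else 0)"
  have "\<beta> \<in> vecs a t" using \<alpha> \<open>0 < a\<close> by (auto simp: vecs_def \<beta>_def PiE_iff)
  then obtain r where "r \<in> {1..n}" "\<forall>j\<in>{1..t}. w j r = \<beta> j"
    using V w(1,2) unfolding wise_perfect_iff by blast
  moreover have "j \<in> {1..t}" "\<beta> j = \<alpha> j" if "j \<in> {1..s}" for j
    using that \<open>s \<le> t\<close> by (auto simp: \<beta>_def)
  ultimately show "\<exists>r\<in>{1..n}. \<forall>j\<in>{1..s}. u j r = \<alpha> j"
    using w(3) by metis
qed

lemma wise_perfect_2D:
  assumes "wise_perfect a 2 n V" "u \<in> V" "v \<in> V" "u \<noteq> v" "x < a" "y < a"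
  obtains r where "r \<in> {1..n}" "u r = x" "v r = y"
proof -
  define w where "w j = (if j = (1::nat) then u else v)" for j
  define \<alpha> where "\<alpha> = (\<lambda>j\<in>{1..2}. if j = (1::nat) then x else y)"
  have "\<alpha> \<in> vecs a 2" using assms by (auto simp: \<alpha>_def vecs_def)
  moreover have "inj_on w {1..2}" "w ` {1..2} \<subseteq> V"
    using assms by (auto simp: w_def inj_on_def split: if_splits)
  ultimately obtain r where r: "r \<in> {1..n}" "\<forall>j\<in>{1..2}. w j r = \<alpha> j"
    using assms(1) unfolding wise_perfect_iff by blast
  thus ?thesis
    using that[of r] bspec[OF r(2), of 1] bspec[OF r(2), of 2] by (simp add: w_def \<alpha>_def)
qed

text \<open>Needed to reason about \<open>Max\<close> in \<open>perfect_num\<close>; all candidates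
  are subsets of the finite set \<open>vecs a n\<close>.\<close>

lemma finite_card_wise_perfect: "finite {card V |V. wise_perfect a t n V}"
proof (rule finite_surj)
  show "finite (Pow (vecs a n))" by (simp add: finite_vecs)
  have "V \<in> Pow (vecs a n)" if "wise_perfect a t n V" for V
    using that by (simp add: wise_perfect_def)
  thus "{card V |V. wise_perfect a t n V} \<subseteq> card ` Pow (vecs a n)" by blast
qed

lemma card_le_perfect_num:
  assumes "wise_perfect a t n V"
  shows "card V \<le> perfect_num a t n"
  unfolding perfect_num_def using finite_card_wise_perfect assms by (intro Max_ge) auto

text \<open>The assumption supplies the nonemptiness that \<open>Max\<close> requires.\<close>

lemma perfect_num_attained:
  assumes "wise_perfect a t n V"
  obtains W where "wise_perfect a t n W" "card W = perfect_num a t n"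
proof -
  have "perfect_num a t n \<in> {card V |V. wise_perfect a t n V}"
    unfolding perfect_num_def using assms by (intro Max_in finite_card_wise_perfect) auto
  thus ?thesis using that by auto
qed

subsection \<open>The upper bound\<close>

text \<open>By pigeonhole some level set \<open>cls x\<close> has at most \<open>k\<close> elements.
  There are two further letters since \<open>3 \<le> a\<close>, and their level sets cannot both
  exceed \<open>n - k\<close>, because \<open>2 * k \<le> n\<close>. So \<open>cls x\<close> can
  grow to size \<open>k\<close> while avoiding one of them.\<close>

lemma vec_separating_set:
  assumes a: "3 \<le> a" and k: "k = n div a" and v: "v \<in> vecs a n"
  shows "\<exists>B \<subseteq> {1..n}. card B = k \<and> (\<exists>x<a. {r \<in> {1..n}. v r = x} \<subseteq> B) \<and>
           (\<exists>z<a. B \<inter> {r \<in> {1..n}. v r = z} = {})"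
proof -
  define cls where "cls x = {r \<in> {1..n}. v r = x}" for x
  have fin: "finite (cls x)" for x by (simp add: cls_def)
  have "{1..n} = (\<Union>x\<in>{..<a}. cls x)" using v by (auto simp: cls_def vecs_def PiE_iff)
  hence "card {1..n} = card (\<Union>x\<in>{..<a}. cls x)" by simp
  also have "\<dots> = (\<Sum>x<a. card (cls x))" by (intro card_UN_disjoint) (auto simp: cls_def)
  finally have n: "n = (\<Sum>x<a. card (cls x))" by simp
  have "\<exists>x<a. card (cls x) \<le> k"
  proof (rule ccontr)
    assume "\<not> ?thesis"
    hence "(\<Sum>x<a. k + 1) \<le> (\<Sum>x<a. card (cls x))" by (intro sum_mono) (auto simp: not_le)
    hence "a * (k + 1) \<le> n" using n by simp
    moreover have "n < a * (k + 1)" using a dividend_less_times_div[of a n] by (simp add: k)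
    ultimately show False by simp
  qed
  then obtain x where x: "x < a" "card (cls x) \<le> k" by blast
  have "k \<le> n div 3" using a by (auto simp: k intro: div_le_mono2)
  hence kn: "2 * k \<le> n" by simp
  \<comment> \<open>The witnesses are the two least letters other than \<open>x\<close>.\<close>
  have "\<exists>y z. y < a \<and> z < a \<and> y \<noteq> x \<and> z \<noteq> x \<and> y \<noteq> z"
    using a by (intro exI[of _ "if x = 0 then 1 else 0"] exI[of _ "if x \<le> 1 then 2 else 1"]) auto
  then obtain y z where yz: "y < a" "z < a" "y \<noteq> x" "z \<noteq> x" "y \<noteq> z" by blast
  have "card (cls y) + card (cls z) = card (cls y \<union> cls z)"
    using yz by (intro card_Un_disjoint[symmetric] fin) (auto simp: cls_def)
  also have "\<dots> \<le> card {1..n}" by (intro card_mono) (auto simp: cls_def)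
  finally have "card (cls y) + card (cls z) \<le> n" by simp
  hence "card (cls y) \<le> n - k \<or> card (cls z) \<le> n - k" using kn by arith
  then obtain w where w: "w < a" "w \<noteq> x" "card (cls w) \<le> n - k" using yz by blast
  have "card ({1..n} - cls w) = n - card (cls w)"
    by (subst card_Diff_subset) (auto simp: cls_def)
  hence "k \<le> card ({1..n} - cls w)" using w(3) kn by simp
  moreover have "cls x \<subseteq> {1..n} - cls w" using w(2) by (auto simp: cls_def)
  ultimately obtain B where B: "cls x \<subseteq> B" "B \<subseteq> {1..n} - cls w" "card B = k"
    using exists_subset_between[of "cls x" k "{1..n} - cls w"] x(2) by auto
  hence "B \<subseteq> {1..n}" "B \<inter> cls w = {}" by auto
  thus ?thesis using x(1) w(1) B unfolding cls_def by blast
qed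

lemma card_wise_perfect_2_le:
  assumes a: "3 \<le> a" "a \<le> n" and V: "wise_perfect a 2 n V"
  shows "card V \<le> (n - 1) choose (n div a - 1)"
proof -
  define k where "k = n div a"
  have k: "0 < k" using a by (simp add: k_def div_greater_zero_iff)
  have "k \<le> n div 3" using a by (auto simp: k_def intro: div_le_mono2)
  hence kn: "2 * k \<le> n" by simp
  have "\<forall>v\<in>V. \<exists>B \<subseteq> {1..n}. card B = k \<and> (\<exists>x<a. {r \<in> {1..n}. v r = x} \<subseteq> B) \<and>
           (\<exists>z<a. B \<inter> {r \<in> {1..n}. v r = z} = {})"
    using vec_separating_set[OF a(1) k_def] V by (simp add: wise_perfect_def subset_iff)
  from bchoice[OF this] obtain B where B: "\<And>v. v \<in> V \<Longrightarrow> B v \<subseteq> {1..n}"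
      "\<And>v. v \<in> V \<Longrightarrow> card (B v) = k"
    and inside: "\<And>v. v \<in> V \<Longrightarrow> \<exists>x<a. {r \<in> {1..n}. v r = x} \<subseteq> B v"
    and outside: "\<And>v. v \<in> V \<Longrightarrow> \<exists>z<a. B v \<inter> {r \<in> {1..n}. v r = z} = {}"
    by blast
  \<comment> \<open>A coordinate with the inside letter of \<open>u\<close> and the outside letter
    of \<open>v\<close> lies in \<open>B u\<close> but not in \<open>B v\<close>.\<close>
  have "inj_on B V"
  proof (rule inj_onI, rule ccontr)
    fix u v assume uv: "u \<in> V" "v \<in> V" "B u = B v" "u \<noteq> v"
    obtain x where x: "x < a" "{r \<in> {1..n}. u r = x} \<subseteq> B u" using inside[OF uv(1)] by blast
    obtain z where z: "z < a" "B v \<inter> {r \<in> {1..n}. v r = z} = {}" using outside[OF uv(2)] by blast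
    obtain r where "r \<in> {1..n}" "u r = x" "v r = z"
      by (rule wise_perfect_2D[OF V uv(1,2,4) x(1) z(1)])
    thus False using x(2) z(2) uv(3) by blast
  qed
  hence "card V = card (B ` V)" by (simp add: card_image)
  also have "\<dots> \<le> (card {1..n} - 1) choose (k - 1)"
  proof (rule erdos_ko_rado)
    fix A A' assume "A \<in> B ` V" "A' \<in> B ` V"
    then obtain u v where uv: "u \<in> V" "v \<in> V" "A = B u" "A' = B v" by blast
    \<comment> \<open>For \<open>u = v\<close> the set is nonempty since \<open>0 < k\<close>.
      Otherwise a coordinate where both vectors show their inside letters lies in both sets.\<close>
    show "A \<inter> A' \<noteq> {}"
    proof (cases "u = v")
      case True
      thus ?thesis using uv B(2)[OF uv(1)] k by auto
    next
      case False
      obtain x where x: "x < a" "{r \<in> {1..n}. u r = x} \<subseteq> B u" using inside[OF uv(1)] by blast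
      obtain y where y: "y < a" "{r \<in> {1..n}. v r = y} \<subseteq> B v" using inside[OF uv(2)] by blast
      obtain r where "r \<in> {1..n}" "u r = x" "v r = y"
        by (rule wise_perfect_2D[OF V uv(1,2) False x(1) y(1)])
      thus ?thesis using x(2) y(2) uv(3,4) by blast
    qed
  qed (use k kn B in auto)
  finally show ?thesis by (simp add: k_def)
qed

text \<open>The constant comes from bounding one term of \<open>(1 + 1/2) ^ n\<close>, which gives
  \<open>(3/2) ^ n * 2 ^ (n/3)\<close>.\<close>

lemma binomial_third_le:
  assumes "3 * k \<le> n"
  shows "real (n choose k) \<le> root 3 (27/4) ^ n"
proof -
  have "real (n choose k) * (1/2) ^ k \<le> (\<Sum>j\<le>n. real (n choose j) * (1/2) ^ j * 1 ^ (n - j))"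
    using assms member_le_sum[of k "{..n}" "\<lambda>j. real (n choose j) * (1/2) ^ j * 1 ^ (n - j)"]
    by simp
  also have "\<dots> = (1/2 + 1) ^ n" by (rule binomial_ring[symmetric])
  finally have "real (n choose k) \<le> (3/2) ^ n * 2 ^ k" by (simp add: power_divide field_simps)
  \<comment> \<open>Cubing clears the exponent \<open>n/3\<close>: the cube of \<open>2 ^ k\<close>
    is \<open>2 ^ (3 * k)\<close>, at most \<open>2 ^ n\<close>.\<close>
  hence "real (n choose k) ^ 3 \<le> ((3/2) ^ n * 2 ^ k) ^ 3" by (intro power_mono) auto
  also have "\<dots> = (27/8) ^ n * 2 ^ (3 * k)"
  proof -
    have "((3/2::real) ^ n) ^ 3 = ((3/2) ^ 3) ^ n" by (simp only: power_mult[symmetric] mult.commute)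
    also have "(3/2::real) ^ 3 = 27/8" by (simp add: power3_eq_cube)
    finally show ?thesis by (simp add: power_mult_distrib power_mult[symmetric] mult.commute)
  qed
  also have "\<dots> \<le> (27/8) ^ n * 2 ^ n"
    using assms by (intro mult_left_mono power_increasing) auto
  also have "\<dots> = (27/4) ^ n" by (simp add: power_mult_distrib[symmetric])
  also have "\<dots> = (root 3 (27/4) ^ 3) ^ n" by simp
  also have "\<dots> = (root 3 (27/4) ^ n) ^ 3" by (simp only: power_mult[symmetric] mult.commute)
  finally show ?thesis
    using power_mono_iff[of "real (n choose k)" "root 3 (27/4) ^ n" 3] by simp
qed

text \<open>Compare cubes: \<open>27/4 < 8\<close>.\<close>

lemma root_27_4_less_2: "root 3 (27/4) < 2"
proof (rule power_less_imp_less_base)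
  show "root 3 (27/4) ^ 3 < 2 ^ 3" by simp
qed simp

subsection \<open>The lower bound\<close>

text \<open>A column showing the pattern is forced at \<open>t\<close> positions and free at the
  other \<open>m - t\<close>; the complement is counted.\<close>

lemma card_columns_avoiding:
  assumes i: "inj_on i {1..t}" "i ` {1..t} \<subseteq> {1..m}" and \<alpha>: "\<alpha> \<in> vecs a t"
  shows "card {c \<in> vecs a m. \<not> (\<forall>j\<in>{1..t}. c (i j) = \<alpha> j)} = a ^ m - a ^ (m - t)"
proof -
  define E where "E = {c \<in> vecs a m. \<forall>j\<in>{1..t}. c (i j) = \<alpha> j}"
  define T where "T = i ` {1..t}"
  have T: "card T = t" "T \<subseteq> {1..m}" using i by (auto simp: T_def card_image)
  \<comment> \<open>Writes the matching columns as a product set: a singleton at each forced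
    position, all letters elsewhere.\<close>
  define A where "A x = (if x \<in> T then {\<alpha> (inv_into {1..t} i x)} else {0..<a})" for x
  have inv: "inv_into {1..t} i (i j) = j" if "j \<in> {1..t}" for j
    using that i by (intro inv_into_f_f) auto
  have "E = (\<Pi>\<^sub>E x\<in>{1..m}. A x)"
  proof (intro equalityI subsetI)
    fix c assume "c \<in> E"
    thus "c \<in> (\<Pi>\<^sub>E x\<in>{1..m}. A x)"
      by (auto simp: E_def A_def vecs_def PiE_iff T_def inv[simplified])
  next
    fix c assume c: "c \<in> (\<Pi>\<^sub>E x\<in>{1..m}. A x)"
    have val: "c (i j) = \<alpha> j" if "j \<in> {1..t}" for j
    proof -
      have "i j \<in> T" using that by (simp add: T_def)
      thus ?thesis using PiE_mem[OF c, of "i j"] T(2) inv[OF that] by (auto simp: A_def)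
    qed
    have "c x < a" if "x \<in> {1..m}" for x
    proof (cases "x \<in> T")
      case True
      then obtain j where "j \<in> {1..t}" "x = i j" by (auto simp: T_def)
      thus ?thesis using val \<alpha> by (auto simp: vecs_def PiE_iff)
    next
      case False
      thus ?thesis using PiE_mem[OF c that] by (simp add: A_def)
    qed
    thus "c \<in> E" using c val by (auto simp: E_def vecs_def PiE_iff)
  qed
  hence "card E = (\<Prod>x\<in>{1..m}. card (A x))" by (simp add: card_PiE)
  also have "\<dots> = (\<Prod>x\<in>{1..m}. if x \<in> T then 1 else a)"
    by (intro prod.cong) (auto simp: A_def)
  also have "\<dots> = a ^ card ({1..m} - T)"
    by (simp add: prod.If_cases Diff_eq)
  also have "card ({1..m} - T) = m - t"
    using T finite_subset[OF T(2)] by (simp add: card_Diff_subset)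
  finally have "card E = a ^ (m - t)" .
  moreover have "{c \<in> vecs a m. \<not> (\<forall>j\<in>{1..t}. c (i j) = \<alpha> j)} = vecs a m - E"
    by (auto simp: E_def)
  moreover have "E \<subseteq> vecs a m" by (auto simp: E_def)
  ultimately show ?thesis
    using finite_vecs finite_subset by (metis card_Diff_subset card_vecs)
qed

text \<open>A family of \<open>m\<close> vectors of length \<open>n\<close> is chosen as \<open>n\<close> columns of length \<open>m\<close>: the columns are
  independent, so the families missing a given pattern at given positions form a product set.\<close>

lemma wise_perfect_exists:
  assumes at: "2 \<le> a" "2 \<le> t" "t \<le> m"
    and less: "m ^ t * a ^ t * (a ^ m - a ^ (m - t)) ^ n < (a ^ m) ^ n"
  obtains V where "wise_perfect a t n V" "card V = m"
proof -
  define I where "I = {i \<in> {1..t} \<rightarrow>\<^sub>E {1..m}. inj_on i {1..t}}"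
  \<comment> \<open>The families, column by column, in which no column shows \<alpha> at the
    positions \<open>i\<close>. The union \<open>U\<close> of these is too small to exhaust all
    families.\<close>
  define bad where "bad i \<alpha> = {1..n} \<rightarrow>\<^sub>E {c \<in> vecs a m. \<not> (\<forall>j\<in>{1..t}. c (i j) = \<alpha> j)}"
    for i :: "nat \<Rightarrow> nat" and \<alpha> :: "nat \<Rightarrow> nat"
  define U where "U = (\<Union>(i, \<alpha>)\<in>I \<times> vecs a t. bad i \<alpha>)"
  have card_bad: "card (bad i \<alpha>) = (a ^ m - a ^ (m - t)) ^ n" if "i \<in> I" "\<alpha> \<in> vecs a t" for i \<alpha>
  proof -
    have "i ` {1..t} \<subseteq> {1..m}" "inj_on i {1..t}" using that by (auto simp: I_def PiE_iff)
    from card_columns_avoiding[OF this(2,1) that(2)] show ?thesis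
      by (simp add: bad_def card_PiE)
  qed
  have fin_bad: "finite (bad i \<alpha>)" for i \<alpha>
    unfolding bad_def using finite_vecs by (intro finite_PiE) auto
  have finI: "finite I" unfolding I_def by (rule finite_subset[of _ "{1..t} \<rightarrow>\<^sub>E {1..m}"]) (auto intro: finite_PiE)
  have "card I \<le> card ({1..t} \<rightarrow>\<^sub>E {1..m})"
    unfolding I_def by (intro card_mono) (auto intro: finite_PiE)
  hence cardI: "card I \<le> m ^ t" by (simp add: card_PiE)
  have "card U \<le> (\<Sum>p\<in>I \<times> vecs a t. card (case p of (i, \<alpha>) \<Rightarrow> bad i \<alpha>))"
    unfolding U_def using finI finite_vecs by (intro card_UN_le) auto
  also have "\<dots> = (\<Sum>p\<in>I \<times> vecs a t. (a ^ m - a ^ (m - t)) ^ n)"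
    by (intro sum.cong) (auto simp: card_bad)
  also have "\<dots> = card I * a ^ t * (a ^ m - a ^ (m - t)) ^ n"
    by (simp add: card_cartesian_product card_vecs)
  also have "\<dots> \<le> m ^ t * a ^ t * (a ^ m - a ^ (m - t)) ^ n"
    using cardI by (intro mult_right_mono) auto
  also have "\<dots> < card ({1..n} \<rightarrow>\<^sub>E vecs a m)"
    using less by (simp add: card_PiE card_vecs)
  finally have "\<not> ({1..n} \<rightarrow>\<^sub>E vecs a m) \<subseteq> U"
    using card_mono[of U "{1..n} \<rightarrow>\<^sub>E vecs a m"] finI finite_vecs fin_bad by (auto simp: U_def)
  then obtain M where M: "M \<in> {1..n} \<rightarrow>\<^sub>E vecs a m" "M \<notin> U" by blast
  have M_hit: "\<exists>r\<in>{1..n}. \<forall>j\<in>{1..t}. M r (i j) = \<alpha> j"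
    if "inj_on i {1..t}" "i ` {1..t} \<subseteq> {1..m}" "\<alpha> \<in> vecs a t" for i \<alpha>
  proof -
    \<comment> \<open>Only extensional maps belong to \<open>I\<close>.\<close>
    define i' where "i' = restrict i {1..t}"
    have "inj_on i' {1..t} \<longleftrightarrow> inj_on i {1..t}" by (intro inj_on_cong) (simp add: i'_def)
    moreover have "i' \<in> {1..t} \<rightarrow>\<^sub>E {1..m}" using that(2) by (auto simp: i'_def)
    ultimately have "i' \<in> I" using that(1) by (simp add: I_def)
    hence "M \<notin> bad i' \<alpha>" using M(2) that(3) by (auto simp: U_def)
    then obtain r where "r \<in> {1..n}" "\<forall>j\<in>{1..t}. M r (i' j) = \<alpha> j"
      using M(1) by (auto simp: bad_def PiE_iff)
    thus ?thesis by (auto simp: i'_def)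
  qed
  \<comment> \<open>Transposition: \<open>M\<close> lists columns, \<open>v\<close> reads off the
    rows.\<close>
  define v where "v j = (\<lambda>r\<in>{1..n}. M r j)" for j
  have v_vec: "v j \<in> vecs a n" if "j \<in> {1..m}" for j
    using M(1) that by (auto simp: v_def vecs_def PiE_iff)
  have hit: "\<exists>r\<in>{1..n}. \<forall>j\<in>{1..t}. v (i j) r = \<alpha> j"
    if "inj_on i {1..t}" "i ` {1..t} \<subseteq> {1..m}" "\<alpha> \<in> vecs a t" for i \<alpha>
    using M_hit[OF that] by (auto simp: v_def)
  \<comment> \<open>Equal rows at distinct indices could not show the letters 1 and 0 in one column,
    yet a pattern starting with 1, 0 is hit once the two indices are padded to a
    \<open>t\<close>-tuple.\<close>
  have inj: "inj_on v {1..m}"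
  proof (rule inj_onI, rule ccontr)
    fix x y assume xy: "x \<in> {1..m}" "y \<in> {1..m}" "v x = v y" "x \<noteq> y"
    define u where "u j = (if j = (1::nat) then x else y)" for j
    have "inj_on u {1..2}" "u ` {1..2} \<subseteq> {1..m}"
      using xy by (auto simp: u_def inj_on_def split: if_splits)
    then obtain w where w: "inj_on w {1..t}" "w ` {1..t} \<subseteq> {1..m}"
        "\<And>j. j \<in> {1..2} \<Longrightarrow> w j = u j"
      using inj_extend[of "{1..m}" u 2 t] at by (metis card_atLeastAtMost diff_Suc_1 finite_atLeastAtMost)
    define \<alpha> where "\<alpha> = (\<lambda>j\<in>{1..t}. if j = (1::nat) then 1 else (0::nat))"
    have "\<alpha> \<in> vecs a t" using at by (auto simp: \<alpha>_def vecs_def)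
    from hit[OF w(1,2) this] obtain r where "\<forall>j\<in>{1..t}. v (w j) r = \<alpha> j" by blast
    hence "v (w 1) r = 1" "v (w 2) r = 0" using at by (auto simp: \<alpha>_def)
    thus False using w(3)[of 1] w(3)[of 2] xy(3) by (simp add: u_def)
  qed
  have card: "card (v ` {1..m}) = m" using inj by (simp add: card_image)
  have "perfect_on a t n m v"
    unfolding perfect_on_def using hit strict_mono_on_imp_inj_on by blast
  hence "wise_perfect a t n (v ` {1..m})"
    unfolding wise_perfect_def card using v_vec at inj by (auto simp: bij_betw_def)
  thus ?thesis using that card by blast
qed

lemma wise_perfect_exponential:
  assumes at: "2 \<le> a" "2 \<le> t"
  obtains c l :: real and N :: nat where "0 < c" "1 < l"
    "\<And>n. N \<le> n \<Longrightarrow> \<exists>V. wise_perfect a t n V \<and> c * l ^ n \<le> real (card V)"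
proof -
  \<comment> \<open>The probability that a uniformly random column misses a given pattern at given
    positions.\<close>
  define q :: real where "q = 1 - 1 / real a ^ t"
  have "1 < real a ^ t" using at by (intro one_less_power) auto
  moreover have "0 < real a ^ t" using at by simp
  ultimately have q: "0 < q" "q < 1" by (simp_all add: q_def)
  \<comment> \<open>Chosen with \<open>l ^ t = 1 / q\<close>, so that a family of size of order
    \<open>l ^ n\<close> balances the factor \<open>q ^ n\<close> in the union bound.\<close>
  define l where "l = root t (1 / q)"
  have l: "1 < l" using at q by (simp add: l_def)
  have lt: "l ^ t = 1 / q" using at q by (simp add: l_def)
  obtain N where N: "real (4 * a * t) < l ^ N" using real_arch_pow[OF l] by blast
  have "\<exists>V. wise_perfect a t n V \<and> 1 / (4 * a) * l ^ n \<le> real (card V)" if n: "N \<le> n" for n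
  proof -
    have "l ^ N \<le> l ^ n" using n l by (intro power_increasing) auto
    hence ln: "real (4 * a * t) < l ^ n" using N by simp
    \<comment> \<open>The divisor \<open>2 * a\<close> makes \<open>m * a\<close> at most half of
      \<open>l ^ n\<close>, so the union bound is strict. The choice of \<open>N\<close> gives
      \<open>2 * t \<le> y\<close>, so rounding down keeps \<open>t \<le> m\<close> and
      \<open>y / 2 \<le> m\<close>; hence the constant \<open>1 / (4 * a)\<close>.\<close>
    define y where "y = l ^ n / (2 * real a)"
    have "2 * real t \<le> y" using ln at by (simp add: y_def field_simps)
    define m where "m = nat \<lfloor>y\<rfloor>"
    have m: "real m \<le> y" "y < real m + 1" using \<open>2 * real t \<le> y\<close> by (auto simp: m_def)
    have "real t < real m + 1" using m \<open>2 * real t \<le> y\<close> at by linarith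
    hence tm: "t \<le> m" by linarith
    have "real m * real a \<le> y * a" using m by (intro mult_right_mono) auto
    also have "\<dots> = l ^ n / 2" using at by (simp add: y_def)
    also have "\<dots> < l ^ n" using l by simp
    finally have "(real m * real a) ^ t < (l ^ n) ^ t" using at by (intro power_strict_mono) auto
    also have "\<dots> = (l ^ t) ^ n" by (simp only: power_mult[symmetric] mult.commute)
    also have "\<dots> = 1 / q ^ n" by (simp add: lt power_one_over)
    finally have "(real m * real a) ^ t * q ^ n < 1" using q by (simp add: field_simps)
    \<comment> \<open>Multiplying by the number of all families turns probabilities back into
      counts.\<close>
    hence "(real m * real a) ^ t * q ^ n * (real a ^ m) ^ n < 1 * (real a ^ m) ^ n"
      using at by (intro mult_strict_right_mono) auto
    hence "real m ^ t * real a ^ t * (real a ^ m * q) ^ n < (real a ^ m) ^ n"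
      by (simp add: power_mult_distrib ac_simps)
    moreover have "real (a ^ m - a ^ (m - t)) = real a ^ m * q"
    proof -
      have "a ^ (m - t) \<le> a ^ m" using at by (intro power_increasing) auto
      moreover have "real a ^ m = real a ^ (m - t) * real a ^ t"
        using tm by (simp add: power_add[symmetric])
      ultimately show ?thesis using at by (simp add: of_nat_diff q_def algebra_simps)
    qed
    ultimately have "real (m ^ t * a ^ t * (a ^ m - a ^ (m - t)) ^ n) < real ((a ^ m) ^ n)"
      by (simp only: of_nat_mult of_nat_power)
    hence "m ^ t * a ^ t * (a ^ m - a ^ (m - t)) ^ n < (a ^ m) ^ n" by (simp only: of_nat_less_iff)
    then obtain V where V: "wise_perfect a t n V" "card V = m"
      using wise_perfect_exists[OF at tm] by blast
    have "1 / (4 * a) * l ^ n = y / 2" by (simp add: y_def)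
    also have "\<dots> \<le> real m" using m(2) \<open>2 * real t \<le> y\<close> at by linarith
    finally show ?thesis using V by blast
  qed
  moreover have "0 < 1 / (4 * real a)" using at by simp
  ultimately show ?thesis using that[of "1 / (4 * real a)" l N] l by auto
qed

section \<open>Choice of the constants and combination of the two bounds\<close>

theorem theorem3:
  fixes a :: nat
  assumes "a \<ge> 3"
  shows "\<exists>(c\<^sub>2::real) (l\<^sub>2::real). c\<^sub>2 > 0 \<and> l\<^sub>2 < 2 \<and>
    (\<forall>t::nat. t \<ge> 2 \<longrightarrow>
      (\<exists>(c\<^sub>1::real) (l\<^sub>1::real) (n\<^sub>0::nat). c\<^sub>1 > 0 \<and> l\<^sub>1 > 1 \<and> n\<^sub>0 \<ge> a ^ t \<and>
        (\<forall>n\<ge>n\<^sub>0.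
           real (perfect_num a t n) \<ge> c\<^sub>1 * l\<^sub>1 ^ n \<and>
           real (perfect_num a 2 n) \<le> c\<^sub>2 * l\<^sub>2 ^ n \<and>
           perfect_num a t n \<le> perfect_num a 2 n \<and>
           perfect_num a 2 n \<le> (n - 1) choose (n div a - 1))))"
\<comment> \<open>The upper constants are fixed before \<open>t\<close>. For every
  \<open>a \<ge> 3\<close> the bound \<open>n div a \<le> n div 3\<close> holds, so this base serves
  all such \<open>a\<close>.\<close>
proof (rule exI[of _ 1], rule exI[of _ "root 3 (27/4)"], intro conjI allI impI)
  fix t :: nat assume t: "2 \<le> t"
  have "2 \<le> a" using assms by simp
  then obtain c l N where clN: "0 < c" "1 < l"
    "\<And>n. N \<le> n \<Longrightarrow> \<exists>V. wise_perfect a t n V \<and> c * l ^ n \<le> real (card V)"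
    using wise_perfect_exponential[OF _ t] by blast
  have main: "c * l ^ n \<le> real (perfect_num a t n) \<and>
        real (perfect_num a 2 n) \<le> 1 * root 3 (27/4) ^ n \<and>
        perfect_num a t n \<le> perfect_num a 2 n \<and>
        perfect_num a 2 n \<le> (n - 1) choose (n div a - 1)" if n: "max N (a ^ t) \<le> n" for n
  proof -
    obtain V where V: "wise_perfect a t n V" "c * l ^ n \<le> real (card V)" using clN(3) n by auto
    have "a ^ 1 \<le> a ^ t" using assms t by (intro power_increasing) auto
    hence an: "a \<le> n" using n by simp
    \<comment> \<open>A largest \<open>t\<close>-wise perfect set is also 2-wise perfect, so its
      size is at most \<open>perfect_num a 2 n\<close>. The set \<open>V\<close> from the lower
      bound ensures that the maxima range over nonempty sets.\<close>
    obtain W where W: "wise_perfect a t n W" "card W = perfect_num a t n"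
      using perfect_num_attained[OF V(1)] by blast
    have W2: "wise_perfect a 2 n W" using wise_perfect_antimono[OF W(1) t] assms by simp
    obtain X where X: "wise_perfect a 2 n X" "card X = perfect_num a 2 n"
      using perfect_num_attained[OF W2] by blast
    define k where "k = n div a"
    have k: "0 < k" using assms an by (simp add: k_def div_greater_zero_iff)
    have "k \<le> n div 3" using assms by (auto simp: k_def intro: div_le_mono2)
    hence k3: "3 * k \<le> n" by simp
    have le: "perfect_num a 2 n \<le> (n - 1) choose (k - 1)"
      using card_wise_perfect_2_le[OF assms an X(1)] X(2) by (simp add: k_def)
    \<comment> \<open>Pascal's rule, where \<open>0 < k\<close> matters; this gives the form
      required by \<open>binomial_third_le\<close>.\<close>
    also have "\<dots> \<le> n choose k" using choose_reduce_nat[of n k] k k3 by simp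
    finally have "real (perfect_num a 2 n) \<le> real (n choose k)" by simp
    also have "\<dots> \<le> root 3 (27/4) ^ n" by (rule binomial_third_le[OF k3])
    finally show ?thesis
      using le V(2) card_le_perfect_num[OF V(1)] card_le_perfect_num[OF W2] W(2)
      by (simp add: k_def)
  qed
  show "\<exists>c\<^sub>1 l\<^sub>1 n\<^sub>0. 0 < c\<^sub>1 \<and> 1 < l\<^sub>1 \<and> a ^ t \<le> n\<^sub>0 \<and>
      (\<forall>n\<ge>n\<^sub>0. c\<^sub>1 * l\<^sub>1 ^ n \<le> real (perfect_num a t n) \<and>
         real (perfect_num a 2 n) \<le> 1 * root 3 (27/4) ^ n \<and>
         perfect_num a t n \<le> perfect_num a 2 n \<and>
         perfect_num a 2 n \<le> (n - 1) choose (n div a - 1))"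
    by (rule exI[of _ c], rule exI[of _ l], rule exI[of _ "max N (a ^ t)"])
      (use clN(1,2) main in \<open>intro conjI allI impI; simp\<close>)
qed (simp_all add: root_27_4_less_2)

end
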